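(* Let $\chi$ be a primitive nonprincipal Dirichlet character with conductor $q>1$. Then for every complex number $z\neq 1$, $$\prod_{k=2}^\infty\left(1-\chi(k)\frac{z}{k}\right)=\frac{(2\pi)^{\varphi(q)/2}}{(1-z)\,\epsilon(q)}\cdot\prod_{\substack{1\le j\le q-1\\ \gcd(j,q)=1}}\frac{1}{\Gamma\left(\frac{j-\chi(j)z}{q}\right)},$$ where $\varphi$ is Euler's totient function and $\epsilon(q)=\sqrt{p}$ if $q$ is a power of a prime $p$, and $\epsilon(q)=1$ otherwise.
   Context: The infinite product denotes $\lim_{N\to\infty}\prod_{k=2}^N$ (the value $0$ is allowed). The function $1/\Gamma$ is the entire function that vanishes at $0,-1,-2,\ldots$. *)

theory Defs
  imports "HOL-Analysis.Analysis" "HOL-Number_Theory.Number_Theory"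
begin

(* Periodicity makes it harmless to take the natural numbers, rather than the integers,
   as the domain of a Dirichlet character. *)
definition dirichlet_character :: "nat \<Rightarrow> (nat \<Rightarrow> complex) \<Rightarrow> bool" where
  "dirichlet_character q chi \<longleftrightarrow> q > 0 \<and>
     (\<forall>n. chi (n + q) = chi n) \<and>
     (\<forall>m n. chi (m * n) = chi m * chi n) \<and>
     (\<forall>n. chi n \<noteq> 0 \<longleftrightarrow> coprime n q)"

definition principal_character :: "nat \<Rightarrow> nat \<Rightarrow> complex" where
  "principal_character q n = (if coprime n q then 1 else 0)"

definition induced_modulus :: "nat \<Rightarrow> (nat \<Rightarrow> complex) \<Rightarrow> nat \<Rightarrow> bool" where
  "induced_modulus q chi d \<longleftrightarrow> d dvd q \<and>
     (\<exists>\<psi>. dirichlet_character d \<psi> \<and> (\<forall>n. coprime n q \<longrightarrow> chi n = \<psi> n))"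

definition conductor :: "nat \<Rightarrow> (nat \<Rightarrow> complex) \<Rightarrow> nat" where
  "conductor q chi = (LEAST d. induced_modulus q chi d)"

definition primitive_character :: "nat \<Rightarrow> (nat \<Rightarrow> complex) \<Rightarrow> bool" where
  "primitive_character q chi \<longleftrightarrow> dirichlet_character q chi \<and> conductor q chi = q"

(* For a prime power q, aprimedivisor q is its unique prime divisor. *)
definition epsilon :: "nat \<Rightarrow> real" where
  "epsilon q = (if primepow q then sqrt (real (aprimedivisor q)) else 1)"

end

theory Submission
  imports Defs
begin

text \<open>
  Group the factors by the residue class of \<open>k\<close> modulo \<open>q\<close>. The class of a unit \<open>j\<close> contributes a
  quotient of Pochhammer symbols at \<open>a\<^sub>j = (j - \<chi>(j) z)/q\<close> and \<open>b\<^sub>j = j/q\<close>. Since \<open>\<Sum>\<^sub>j \<chi>(j) = 0\<close>, we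
  have \<open>\<Sum>\<^sub>j a\<^sub>j = \<Sum>\<^sub>j b\<^sub>j\<close>, so the powers in Gauss's limit for \<open>1/\<Gamma>\<close> cancel, and the product over all
  \<open>k \<ge> 1\<close> is \<open>\<Prod>\<^sub>j \<Gamma>(b\<^sub>j)/\<Gamma>(a\<^sub>j)\<close>. The square of \<open>\<Prod>\<^sub>j \<Gamma>(j/q)\<close> is found by pairing \<open>j\<close> with \<open>q - j\<close>
  in the reflection formula, which leaves \<open>\<Prod>\<^sub>j 2 sin(\<pi>j/q)\<close> (this is \<open>\<Phi>\<^sub>q(1)\<close>); comparing
  \<open>\<Prod> {2 sin(\<pi>k/n) | 0 < k < n} = n\<close> with \<open>\<Sum> {\<Lambda>(d) | d dvd n} = ln n\<close> shows by induction over the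
  divisors that its logarithm is the von Mangoldt function \<open>\<Lambda>(q)\<close>.
\<close>

section \<open>The product of the Gamma values at reduced fractions\<close>

text \<open>The nontrivial \<open>n\<close>-th roots of unity are exactly the roots of 1 + X + ... +
  X^(n-1); the claim is the value at X = 1.\<close>

lemma prod_one_minus_unity_roots:
  assumes "n > 0"
  shows   "(\<Prod>j\<in>{0<..<n}. 1 - exp (2 * of_real pi * \<i> * of_nat j / of_nat n)) = (of_nat n :: complex)"
proof -
  define w :: "nat \<Rightarrow> complex" where "w = (\<lambda>j. exp (2 * of_real pi * \<i> * of_nat j / of_nat n))"
  define P where "P = (\<Prod>j\<in>{0<..<n}. [:- w j, 1:])"
  define Q :: "complex poly" where "Q = (\<Sum>i<n. Polynomial.monom 1 i)"
  have inj: "inj_on w {0<..<n}"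
    using assms by (auto simp: inj_on_def w_def complex_root_unity_eq)
  have deg: "Polynomial.degree P = n - 1"
    unfolding P_def by (subst degree_prod_sum_eq) auto
  \<comment> \<open>Both polynomials have degree at most n - 1 and the same coefficient there, so
    their difference has smaller degree and vanishes once they agree at the n - 1 distinct points
    \<open>w j\<close>.\<close>
  have "P = Q"
  proof (rule poly_eqI_degree_lead_coeff[where A = "w ` {0<..<n}" and n = "n - 1"])
    have "Polynomial.coeff P (n - 1) = 1"
      using lead_coeff_prod[of "\<lambda>j. [:- w j, 1:]" "{0<..<n}"] deg by (simp add: P_def)
    moreover have "Polynomial.coeff Q (n - 1) = 1"
      using assms by (simp add: Q_def coeff_sum)
    ultimately show "Polynomial.coeff P (n - 1) = Polynomial.coeff Q (n - 1)" by simp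
    show "card (w ` {0<..<n}) \<ge> n - 1"
      using inj by (simp add: card_image)
    show "Polynomial.degree P \<le> n - 1" using deg by simp
    show "Polynomial.degree Q \<le> n - 1"
      unfolding Q_def by (intro degree_sum_le) (auto intro: order.trans[OF degree_monom_le])
  next
    fix x assume "x \<in> w ` {0<..<n}"
    then obtain j where j: "j > 0" "j < n" "x = w j" by auto
    have "x ^ n = 1"
      using assms j complex_root_unity[of n j] by (simp add: w_def)
    moreover have "x \<noteq> 1"
      using j complex_root_unity_eq_1[of n j] by (auto simp: w_def dest: dvd_imp_le)
    ultimately have "poly Q x = 0"
      by (simp add: Q_def poly_sum poly_monom sum_gp_strict)
    moreover have "poly P x = 0"
      using j by (auto simp: P_def poly_prod)
    ultimately show "poly P x = poly Q x" by simp
  qed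
  hence "poly P 1 = poly Q 1" by simp
  thus ?thesis by (simp add: P_def Q_def poly_prod poly_sum poly_monom w_def)
qed

text \<open>Norms of the previous product: |1 - exp(2it)| = 2 |sin t|, and the sine is nonnegative
  on [0, pi].\<close>

lemma prod_two_sin:
  assumes "n > 0"
  shows   "(\<Prod>j\<in>{0<..<n}. 2 * sin (pi * (real j / real n))) = real n"
proof -
  have "real n = norm (\<Prod>j\<in>{0<..<n}. 1 - exp (2 * of_real pi * \<i> * of_nat j / of_nat n) :: complex)"
    using prod_one_minus_unity_roots[OF assms] by simp
  also have "\<dots> = (\<Prod>j\<in>{0<..<n}. norm (1 - exp (2 * of_real pi * \<i> * of_nat j / of_nat n) :: complex))"
    by (simp add: prod_norm)
  also have "\<dots> = (\<Prod>j\<in>{0<..<n}. 2 * sin (pi * (real j / real n)))"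
  proof (intro prod.cong refl)
    fix j assume j: "j \<in> {0<..<n}"
    have "norm (1 - exp (2 * of_real pi * \<i> * of_nat j / of_nat n) :: complex) =
          norm (exp (\<i> * of_real (2 * pi * (real j / real n))) - 1)"
      by (subst norm_minus_commute) (simp add: field_simps)
    also have "\<dots> = 2 * \<bar>sin (pi * (real j / real n))\<bar>"
      by (subst dist_exp_i_1) simp
    also have "sin (pi * (real j / real n)) \<ge> 0"
      using j by (intro sin_ge_zero) (auto simp: field_simps)
    hence "2 * \<bar>sin (pi * (real j / real n))\<bar> = 2 * sin (pi * (real j / real n))" by simp
    finally show "norm (1 - exp (2 * of_real pi * \<i> * of_nat j / of_nat n) :: complex) =
                  2 * sin (pi * (real j / real n))" .
  qed
  finally show ?thesis ..
qed

text \<open>Reduce each k/n to lowest terms: gcd(k, n) = d gives the denominator n/d, and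
  complementary divisors are swapped at the end.\<close>

lemma sum_fractions_by_denominator:
  fixes h :: "real \<Rightarrow> 'a :: comm_monoid_add"
  assumes "n > 0"
  shows   "(\<Sum>k\<in>{0<..n}. h (real k / real n)) =
           (\<Sum>d | d dvd n. \<Sum>j\<in>totatives d. h (real j / real d))"
proof -
  have "(\<Sum>k\<in>{0<..n}. h (real k / real n)) =
        (\<Sum>d | d dvd n. \<Sum>k | k \<in> {0<..n} \<and> gcd k n = d. h (real k / real n))"
    using assms by (intro sum.group [symmetric]) auto
  also have "\<dots> = (\<Sum>d | d dvd n. \<Sum>j\<in>totatives (n div d). h (real j / real (n div d)))"
  proof (rule sum.cong [OF refl])
    fix d assume "d \<in> {d. d dvd n}"
    hence d: "d dvd n" "d > 0" using assms by (auto intro: Nat.gr0I)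
    have "(\<Sum>k | k \<in> {0<..n} \<and> gcd k n = d. h (real k / real n)) =
          (\<Sum>j\<in>totatives (n div d). h (real (j * d) / real n))"
      using d assms bij_betw_totatives_gcd_eq[of d n] by (intro sum.reindex_bij_betw [symmetric]) auto
    also have "\<dots> = (\<Sum>j\<in>totatives (n div d). h (real j / real (n div d)))"
      using d by (simp add: real_of_nat_div)
    finally show "(\<Sum>k | k \<in> {0<..n} \<and> gcd k n = d. h (real k / real n)) =
                  (\<Sum>j\<in>totatives (n div d). h (real j / real (n div d)))" .
  qed
  also have "\<dots> = (\<Sum>d | d dvd n. \<Sum>j\<in>totatives d. h (real j / real d))"
    by (rule sum.reindex_bij_witness[of _ "(div) n" "(div) n"]) (use assms in \<open>auto elim: dvdE\<close>)
  finally show ?thesis .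
qed

text \<open>Both sides have divisor sum ln n, so agreement at the proper divisors forces agreement
  at \<open>n\<close>.\<close>

lemma sum_ln_two_sin_totatives:
  assumes "n > 0"
  shows   "(\<Sum>j\<in>totatives n. ln (2 * sin (pi * (real j / real n)))) = mangoldt n"
  using assms
proof (induction n rule: less_induct)
  case (less n)
  define h where "h = (\<lambda>x. ln (2 * sin (pi * x)))"
  define T where "T = (\<lambda>d. \<Sum>j\<in>totatives d. h (real j / real d))"
  have "(\<Sum>d | d dvd n. T d) = (\<Sum>k\<in>{0<..n}. h (real k / real n))"
    unfolding T_def using less.prems by (rule sum_fractions_by_denominator [symmetric])
  \<comment> \<open>The term \<open>k = n\<close> vanishes thanks to the convention \<open>ln 0 = 0\<close>.\<close>
  also have "\<dots> = (\<Sum>k\<in>{0<..<n}. h (real k / real n))"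
    using less.prems by (intro sum.mono_neutral_right) (auto simp: h_def)
  also have "\<dots> = ln (\<Prod>k\<in>{0<..<n}. 2 * sin (pi * (real k / real n)))"
    unfolding h_def
  proof (subst ln_prod)
    fix k assume "k \<in> {0<..<n}"
    hence "sin (pi * (real k / real n)) > 0"
      by (intro sin_gt_zero) (auto simp: field_simps)
    thus "2 * sin (pi * (real k / real n)) \<noteq> 0" by simp
  qed simp_all
  also have "\<dots> = (\<Sum>d | d dvd n. mangoldt d)"
    using less.prems by (simp only: prod_two_sin mangoldt_sum) simp
  finally have eq: "(\<Sum>d | d dvd n. T d) = (\<Sum>d | d dvd n. mangoldt d)" .
  have fin: "finite {d. d dvd n}" using less.prems by simp
  have "(\<Sum>d\<in>{d. d dvd n} - {n}. T d) = (\<Sum>d\<in>{d. d dvd n} - {n}. mangoldt d)"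
  proof (intro sum.cong refl)
    fix d assume "d \<in> {d. d dvd n} - {n}"
    hence "d < n" "d > 0" using less.prems by (auto dest: dvd_imp_le intro: Nat.gr0I)
    thus "T d = mangoldt d" unfolding T_def h_def by (rule less.IH)
  qed
  hence "T n = mangoldt n"
    using eq fin by (simp add: sum.remove[of _ n])
  thus ?case by (simp add: T_def h_def)
qed

text \<open>Turns the logarithmic evaluation of the sine product into \<open>epsilon\<close>:
  \<open>mangoldt q\<close> is ln p at powers of a prime p and 0 elsewhere.\<close>

lemma epsilon_squared: "epsilon q ^ 2 = exp (mangoldt q)"
  by (auto simp: epsilon_def mangoldt_def primepow_gt_0_nat intro!: aprimedivisor_pos_nat
      dest: primepow_gt_Suc_0)

lemma epsilon_pos: "epsilon q > 0"
  by (auto simp: epsilon_def intro!: aprimedivisor_pos_nat dest: primepow_gt_Suc_0)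

lemma bij_betw_totatives_reflect:
  assumes "q > 1"
  shows   "bij_betw (\<lambda>j. q - j) (totatives q) (totatives q)"
proof (rule bij_betwI[where g = "\<lambda>j. q - j"])
  have "q - j \<in> totatives q" if "j \<in> totatives q" for j
  proof -
    have "j < q" using that assms by (rule totatives_less)
    moreover from this have "coprime (q - j) q"
      using that by (metis coprime_iff_gcd_eq_1 gcd_diff2_nat in_totatives_iff)
    ultimately show ?thesis by (simp add: in_totatives_iff)
  qed
  thus "(\<lambda>j. q - j) \<in> totatives q \<rightarrow> totatives q"
       "(\<lambda>j. q - j) \<in> totatives q \<rightarrow> totatives q" by auto
qed (auto dest: totatives_le)

text \<open>At integers both sides are 0: one of the Gamma values sits at a pole, and division by 0
  gives 0.\<close>

lemma Gamma_reflection_real: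
  fixes x :: real
  shows "Gamma x * Gamma (1 - x) = pi / sin (pi * x)"
proof -
  have "complex_of_real (Gamma x * Gamma (1 - x)) = of_real (pi / sin (pi * x))"
    using Gamma_reflection_complex[of "of_real x"]
    by (simp flip: Gamma_complex_of_real sin_of_real)
  thus ?thesis by (simp only: of_real_eq_iff)
qed

lemma prod_Gamma_totatives:
  assumes "q > 1"
  shows   "(\<Prod>j\<in>totatives q. Gamma (real j / real q)) =
             (2 * pi) powr (real (totient q) / 2) / epsilon q"
proof -
  define G where "G = (\<Prod>j\<in>totatives q. Gamma (real j / real q))"
  have bounds: "0 < j" "j < q" if "j \<in> totatives q" for j
    using that assms totatives_less[of j q] by (auto simp: in_totatives_iff)
  have sin_pos: "sin (pi * (real j / real q)) > 0" if "j \<in> totatives q" for j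
    using bounds[OF that] by (intro sin_gt_zero) (auto simp: field_simps)
  \<comment> \<open>Positivity is what lets the value of \<open>G ^ 2\<close> determine
    \<open>G\<close> in the end.\<close>
  have "G > 0"
    unfolding G_def using bounds by (intro prod_pos) force
  have "G = (\<Prod>j\<in>totatives q. Gamma (real (q - j) / real q))"
    unfolding G_def
    by (rule prod.reindex_bij_betw[OF bij_betw_totatives_reflect[OF assms], symmetric])
  hence "G ^ 2 = (\<Prod>j\<in>totatives q. Gamma (real j / real q) * Gamma (real (q - j) / real q))"
    by (simp add: power2_eq_square prod.distrib G_def)
  \<comment> \<open>The fraction is expanded by 2 to produce the factors 2 sin, whose product is
    known.\<close>
  also have "\<dots> = (\<Prod>j\<in>totatives q. 2 * pi / (2 * sin (pi * (real j / real q))))"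
  proof (intro prod.cong refl)
    fix j assume "j \<in> totatives q"
    hence "real (q - j) / real q = 1 - real j / real q"
      using bounds[of j] by (simp add: field_simps of_nat_diff)
    thus "Gamma (real j / real q) * Gamma (real (q - j) / real q) =
            2 * pi / (2 * sin (pi * (real j / real q)))"
      using Gamma_reflection_real[of "real j / real q"] by simp
  qed
  also have "\<dots> = (2 * pi) ^ totient q / (\<Prod>j\<in>totatives q. 2 * sin (pi * (real j / real q)))"
    by (simp only: prod_dividef prod_constant totient_def)
  also have "(\<Prod>j\<in>totatives q. 2 * sin (pi * (real j / real q))) =
             exp (\<Sum>j\<in>totatives q. ln (2 * sin (pi * (real j / real q))))"
    using sin_pos by (simp add: exp_sum)
  also have "\<dots> = epsilon q ^ 2"
    using assms by (subst sum_ln_two_sin_totatives) (auto simp: epsilon_squared)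
  also have "(2 * pi) ^ totient q = ((2 * pi) powr (real (totient q) / 2)) ^ 2"
    by (simp add: powr_realpow powr_half_sqrt power2_eq_square flip: powr_add)
  finally have "G ^ 2 = ((2 * pi) powr (real (totient q) / 2) / epsilon q) ^ 2"
    by (simp add: power_divide)
  thus ?thesis
    using \<open>G > 0\<close> epsilon_pos[of q] unfolding G_def
    by (subst (asm) power2_eq_iff_nonneg) auto
qed

section \<open>Products of rational functions of the index\<close>

text \<open>In the quotients of Gauss's approximations the factorials cancel for each
  \<open>j\<close>, the powers of N only across the whole product, by equality of the sums. The
  condition on \<open>b\<close> keeps the limiting denominators nonzero.\<close>

lemma tendsto_prod_pochhammer_quotient:
  fixes a b :: "'j \<Rightarrow> complex"
  assumes b: "\<And>j. j \<in> J \<Longrightarrow> b j \<notin> \<int>\<^sub>\<le>\<^sub>0"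
    and sums: "(\<Sum>j\<in>J. a j) = (\<Sum>j\<in>J. b j)"
  shows "(\<lambda>N. \<Prod>j\<in>J. pochhammer (a j) N / pochhammer (b j) N)
           \<longlonglongrightarrow> (\<Prod>j\<in>J. rGamma (a j) / rGamma (b j))"
proof (rule filterlim_sequentially_Suc [THEN iffD1])
  \<comment> \<open>\<open>rGamma_series\<close> at N involves a Pochhammer symbol of length N + 1,
    hence the shift of the index.\<close>
  have "(\<Prod>j\<in>J. rGamma_series (a j) N / rGamma_series (b j) N) =
        (\<Prod>j\<in>J. pochhammer (a j) (Suc N) / pochhammer (b j) (Suc N))" for N
  proof -
    define L where "L = complex_of_real (ln (real N))"
    have "(\<Prod>j\<in>J. rGamma_series (a j) N / rGamma_series (b j) N) =
          (\<Prod>j\<in>J. pochhammer (a j) (Suc N) / pochhammer (b j) (Suc N) * exp ((b j - a j) * L))"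
      by (intro prod.cong refl) (simp add: rGamma_series_def L_def left_diff_distrib exp_diff)
    also have "\<dots> = (\<Prod>j\<in>J. pochhammer (a j) (Suc N) / pochhammer (b j) (Suc N)) *
                    (\<Prod>j\<in>J. exp ((b j - a j) * L))"
      by (rule prod.distrib)
    also have "(\<Prod>j\<in>J. exp ((b j - a j) * L)) = 1"
    proof (cases "finite J")
      case True
      have "(\<Sum>j\<in>J. (b j - a j) * L) = 0"
        using sums by (simp add: sum_subtractf flip: sum_distrib_right)
      thus ?thesis using True by (simp flip: exp_sum)
    qed simp
    finally show ?thesis by simp
  qed
  moreover have "(\<lambda>N. \<Prod>j\<in>J. rGamma_series (a j) N / rGamma_series (b j) N)
                   \<longlonglongrightarrow> (\<Prod>j\<in>J. rGamma (a j) / rGamma (b j))"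
    using b by (intro tendsto_intros) (auto simp: rGamma_eq_zero_iff)
  ultimately show "(\<lambda>N. \<Prod>j\<in>J. pochhammer (a j) (Suc N) / pochhammer (b j) (Suc N))
                     \<longlonglongrightarrow> (\<Prod>j\<in>J. rGamma (a j) / rGamma (b j))" by simp
qed

text \<open>There are finitely many classes, so one threshold on the quotient n div q serves all of
  them.\<close>

lemma LIMSEQ_residue_classes:
  fixes X :: "nat \<Rightarrow> 'a :: topological_space"
  assumes "q > 0" and lim: "\<And>r. r < q \<Longrightarrow> (\<lambda>m. X (m * q + r)) \<longlonglongrightarrow> L"
  shows   "X \<longlonglongrightarrow> L"
proof (rule topological_tendstoI)
  fix S assume S: "open S" "L \<in> S"
  have "\<forall>\<^sub>F m in sequentially. \<forall>r\<in>{..<q}. X (m * q + r) \<in> S"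
    using topological_tendstoD[OF lim S] by (intro eventually_ball_finite) auto
  moreover have "filterlim (\<lambda>n. n div q) at_top sequentially"
    using \<open>q > 0\<close> by (rule filterlim_at_top_div_const_nat)
  ultimately have "\<forall>\<^sub>F n in sequentially. \<forall>r\<in>{..<q}. X (n div q * q + r) \<in> S"
    by (rule eventually_compose_filterlim)
  thus "\<forall>\<^sub>F n in sequentially. X n \<in> S"
    by eventually_elim (use \<open>q > 0\<close> in \<open>metis div_mult_mod_eq lessThan_iff mod_less_divisor\<close>)
qed

text \<open>A partial product that stops inside a block has fewer than \<open>q\<close> extra
  factors, each tending to 1; they are added one at a time.\<close>

lemma LIMSEQ_prod_blocks:
  fixes f :: "nat \<Rightarrow> 'a :: real_normed_field"
  assumes "q > 0" and f: "f \<longlonglongrightarrow> 1" and lim: "(\<lambda>m. \<Prod>i<m * q. f i) \<longlonglongrightarrow> L"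
  shows   "(\<lambda>n. \<Prod>i<n. f i) \<longlonglongrightarrow> L"
proof (rule LIMSEQ_residue_classes[OF \<open>q > 0\<close>])
  fix r :: nat
  show "(\<lambda>m. \<Prod>i<m * q + r. f i) \<longlonglongrightarrow> L"
  proof (induction r)
    case (Suc r)
    have "filterlim (\<lambda>m. m * q + r) at_top sequentially"
      using \<open>q > 0\<close> by (intro filterlim_subseq) (auto simp: strict_mono_def)
    hence "(\<lambda>m. f (m * q + r)) \<longlonglongrightarrow> 1"
      by (rule filterlim_compose[OF f])
    from tendsto_mult[OF Suc this] show ?case by simp
  qed (use lim in simp)
qed

section \<open>Dirichlet characters\<close>

lemma dirichlet_character_mod:
  assumes "dirichlet_character q chi"
  shows   "chi (n mod q) = chi n"
proof -
  have periodic: "chi (n + q) = chi n" for n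
    using assms by (simp add: dirichlet_character_def)
  have "chi (n + m * q) = chi n" for n m
  proof (induction m)
    case (Suc m)
    thus ?case using periodic[of "n + m * q"] by (simp add: algebra_simps)
  qed simp
  from this[of "n mod q" "n div q"] show ?thesis by simp
qed

lemma dirichlet_character_1:
  assumes "dirichlet_character q chi"
  shows   "chi 1 = 1"
proof -
  have "chi (1 * 1) = chi 1 * chi 1" and "chi 1 \<noteq> 0"
    using assms unfolding dirichlet_character_def by (blast, simp)
  thus ?thesis by simp
qed

text \<open>Multiplication by a unit \<open>a\<close> permutes the reduced residues, so the sum S
  satisfies S = chi(a) S; choose \<open>a\<close> with chi(a) different from 1.\<close>

lemma sum_totatives_dirichlet_character:
  assumes "q > 1" "dirichlet_character q chi" "chi \<noteq> principal_character q"
  shows   "(\<Sum>j\<in>totatives q. chi j) = 0"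
proof -
  from assms(2) have mult: "chi (m * n) = chi m * chi n"
    and zero: "chi n = 0 \<longleftrightarrow> \<not>coprime n q" for m n
    unfolding dirichlet_character_def by blast+
  \<comment> \<open>Off the units both characters vanish, so they must differ at a unit.\<close>
  obtain a where a: "coprime a q" "chi a \<noteq> 1"
    using assms(3) zero unfolding principal_character_def by fastforce
  have bij: "bij_betw (\<lambda>j. a * j mod q) (totatives q) (totatives q)"
    unfolding bij_betw_def
  proof (rule conjI)
    show inj: "inj_on (\<lambda>j. a * j mod q) (totatives q)"
    proof (rule inj_onI)
      fix i j assume ij: "i \<in> totatives q" "j \<in> totatives q" "a * i mod q = a * j mod q"
      hence "[i = j] (mod q)"
        using a(1) by (simp add: cong_mult_lcancel_nat flip: cong_def)
      thus "i = j"
        using ij totatives_less[of _ q] assms(1) by (simp add: cong_less_modulus_unique_nat)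
    qed
    have "a * j mod q \<in> totatives q" if "j \<in> totatives q" for j
    proof -
      have cop: "coprime (a * j mod q) q"
        using that a(1) assms(1) by (simp add: in_totatives_iff)
      moreover from cop have "a * j mod q \<noteq> 0"
        using assms(1) by (intro notI) simp
      ultimately show ?thesis
        using assms(1) by (simp add: in_totatives_iff less_imp_le)
    qed
    hence "(\<lambda>j. a * j mod q) ` totatives q \<subseteq> totatives q" by auto
    thus "(\<lambda>j. a * j mod q) ` totatives q = totatives q"
      using inj by (intro endo_inj_surj) auto
  qed
  have "(\<Sum>j\<in>totatives q. chi j) = (\<Sum>j\<in>totatives q. chi (a * j mod q))"
    by (rule sum.reindex_bij_betw[OF bij, symmetric])
  also have "\<dots> = chi a * (\<Sum>j\<in>totatives q. chi j)"
    by (simp only: dirichlet_character_mod[OF assms(2)] mult sum_distrib_left)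
  finally show ?thesis using a(2) by simp
qed

text \<open>By periodicity only finitely many values occur. The bound serves to show that the
  factors of the product tend to 1.\<close>

lemma dirichlet_character_bounded:
  assumes "dirichlet_character q chi"
  shows   "\<exists>C. \<forall>n. norm (chi n) \<le> C"
proof -
  have "q > 0" using assms by (simp add: dirichlet_character_def)
  hence "norm (chi n) \<le> Max ((\<lambda>k. norm (chi k)) ` {..<q})" for n
    by (subst dirichlet_character_mod[OF assms, symmetric]) (intro Max_ge, auto)
  thus ?thesis by blast
qed

section \<open>Evaluation of the infinite product\<close>

theorem theorem1:
  fixes q :: nat and chi :: "nat \<Rightarrow> complex" and z :: complex
  assumes "q > 1"
    and "primitive_character q chi"
    and "chi \<noteq> principal_character q"
    and "z \<noteq> 1"
  shows "(\<lambda>N. \<Prod>k = 2..N. (1 - chi k * (z / of_nat k))) \<longlonglongrightarrow>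
           of_real ((2 * pi) powr (real (totient q) / 2)) / ((1 - z) * of_real (epsilon q)) *
           (\<Prod>j | 1 \<le> j \<and> j \<le> q - 1 \<and> gcd j q = 1. rGamma ((of_nat j - chi j * z) / of_nat q))"
proof -
  have chi: "dirichlet_character q chi"
    using assms(2) by (simp add: primitive_character_def)
  define f where "f = (\<lambda>k. 1 - chi k * (z / of_nat k))"
  define J where "J = totatives q"
  define a where "a = (\<lambda>j. (of_nat j - chi j * z) / of_nat q)"
  define b :: "nat \<Rightarrow> complex" where "b = (\<lambda>j. of_nat j / of_nat q)"
  define c where "c = complex_of_real ((2 * pi) powr (real (totient q) / 2) / epsilon q)"

  have J_eq: "{j. 1 \<le> j \<and> j \<le> q - 1 \<and> gcd j q = 1} = J"
  proof (intro Set.set_eqI iffI)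
    fix j assume "j \<in> J"
    moreover from this have "j < q"
      using assms(1) unfolding J_def by (rule totatives_less)
    ultimately show "j \<in> {j. 1 \<le> j \<and> j \<le> q - 1 \<and> gcd j q = 1}"
      by (auto simp: J_def in_totatives_iff)
  qed (auto simp: J_def in_totatives_iff intro: gcd_eq_1_imp_coprime)

  have b_pos: "b j \<notin> \<int>\<^sub>\<le>\<^sub>0" if "j \<in> J" for j
  proof -
    have "b j = of_real (real j / real q)" "real j / real q > 0"
      using that assms(1) by (auto simp: b_def J_def in_totatives_iff)
    thus ?thesis by (auto simp: complex_nonpos_Reals_iff dest!: subsetD[OF nonpos_Ints_subset_nonpos_Reals])
  qed

  have "(\<Sum>j\<in>J. a j) = (\<Sum>j\<in>J. b j) - (\<Sum>j\<in>J. chi j) * z / of_nat q"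
    by (simp add: a_def b_def diff_divide_distrib sum_subtractf sum_distrib_right sum_divide_distrib)
  hence sums: "(\<Sum>j\<in>J. a j) = (\<Sum>j\<in>J. b j)"
    using sum_totatives_dirichlet_character[OF assms(1) chi assms(3)] by (simp add: J_def)

  have blocks: "(\<Prod>i<m * q. f (Suc i)) = (\<Prod>j\<in>J. pochhammer (a j) m / pochhammer (b j) m)" for m
  proof -
    have "(\<Prod>i<m * q. f (Suc i)) = (\<Prod>l<m. \<Prod>i\<in>{l * q..<l * q + q}. f (Suc i))"
      by (rule prod.nat_group [symmetric])
    also have "\<dots> = (\<Prod>l<m. \<Prod>j\<in>J. (a j + of_nat l) / (b j + of_nat l))"
    proof (rule prod.cong [OF refl])
      fix l
      have shift: "chi (j + l * q) = chi j" for j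
        using dirichlet_character_mod[OF chi, of "j + l * q"] dirichlet_character_mod[OF chi, of j]
        by simp
      \<comment> \<open>Writing \<open>Suc i\<close> as \<open>j + l * q\<close> makes j run from 1
        to q; the class of 0 is represented by j = q.\<close>
      have "(\<Prod>i\<in>{l * q..<l * q + q}. f (Suc i)) = (\<Prod>j\<in>{0<..q}. f (j + l * q))"
        by (intro prod.reindex_bij_witness[of _ "\<lambda>j. j + l * q - 1" "\<lambda>i. Suc i - l * q"]) auto
      also have "\<dots> = (\<Prod>j\<in>J. f (j + l * q))"
      proof (intro prod.mono_neutral_right ballI)
        fix j assume "j \<in> {0<..q} - J"
        hence "\<not>coprime j q"
          by (auto simp: J_def in_totatives_iff)
        hence "chi (j + l * q) = 0"
          using chi unfolding shift by (auto simp: dirichlet_character_def)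
        thus "f (j + l * q) = 1"
          by (simp add: f_def)
      qed (auto simp: J_def in_totatives_iff)
      also have "\<dots> = (\<Prod>j\<in>J. (a j + of_nat l) / (b j + of_nat l))"
      proof (intro prod.cong refl)
        fix j assume j: "j \<in> J"
        \<comment> \<open>The factor is (w - chi(j) z) / w; dividing top and bottom by
          \<open>q\<close> exhibits the l-th Pochhammer factors at \<open>a j\<close> and
          \<open>b j\<close>.\<close>
        define w :: complex where "w = of_nat (j + l * q)"
        have "w \<noteq> 0"
          unfolding w_def of_nat_eq_0_iff using j by (auto simp: J_def in_totatives_iff)
        moreover have "a j + of_nat l = (w - chi j * z) / of_nat q" "b j + of_nat l = w / of_nat q"
          using assms(1) by (simp_all add: a_def b_def w_def field_simps)
        moreover have "f (j + l * q) = 1 - chi j * (z / w)"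
          by (simp only: f_def shift w_def)
        ultimately show "f (j + l * q) = (a j + of_nat l) / (b j + of_nat l)"
          using assms(1) by (simp add: diff_divide_eq_iff)
      qed
      finally show "(\<Prod>i\<in>{l * q..<l * q + q}. f (Suc i)) =
                    (\<Prod>j\<in>J. (a j + of_nat l) / (b j + of_nat l))" .
    qed
    also have "\<dots> = (\<Prod>j\<in>J. \<Prod>l<m. (a j + of_nat l) / (b j + of_nat l))"
      by (rule prod.swap)
    also have "\<dots> = (\<Prod>j\<in>J. pochhammer (a j) m / pochhammer (b j) m)"
      by (simp add: pochhammer_prod prod_dividef atLeast0LessThan)
    finally show ?thesis .
  qed

  obtain C where C: "\<And>n. norm (chi n) \<le> C"
    using dirichlet_character_bounded[OF chi] by blast
  have "(\<lambda>k. chi k * (z / of_nat k)) \<longlonglongrightarrow> 0"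
    by (rule lim_null_mult_left_bounded[where B = C]) (use C in \<open>auto intro!: lim_const_over_n\<close>)
  hence f_lim: "(\<lambda>k. f (Suc k)) \<longlonglongrightarrow> 1"
    using tendsto_diff[OF tendsto_const[of 1]] unfolding f_def by (intro LIMSEQ_Suc) fastforce

  have "(\<Prod>j\<in>J. Gamma (b j)) = (\<Prod>j\<in>J. of_real (Gamma (real j / real q)))"
    by (simp add: b_def flip: Gamma_complex_of_real)
  also have "\<dots> = c"
    using prod_Gamma_totatives[OF assms(1)] by (simp add: J_def c_def flip: of_real_prod)
  finally have "(\<Prod>j\<in>J. rGamma (a j) / rGamma (b j)) = c * (\<Prod>j\<in>J. rGamma (a j))"
    by (simp add: prod.distrib Gamma_def divide_inverse mult.commute)
  hence "(\<lambda>m. \<Prod>i<m * q. f (Suc i)) \<longlonglongrightarrow> c * (\<Prod>j\<in>J. rGamma (a j))"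
    using tendsto_prod_pochhammer_quotient[OF b_pos sums] by (simp add: blocks)
  hence lim: "(\<lambda>n. \<Prod>i<n. f (Suc i)) \<longlonglongrightarrow> c * (\<Prod>j\<in>J. rGamma (a j))"
    using assms(1) f_lim by (intro LIMSEQ_prod_blocks[of q]) auto

  have f1: "f 1 = 1 - z"
    using dirichlet_character_1[OF chi] by (simp add: f_def)
  \<comment> \<open>The limit found so far includes the factor at k = 1, present once n >= 1; since
    z is not 1 it can be divided out.\<close>
  have "(\<Prod>k = 2..n. f k) = (\<Prod>i<n. f (Suc i)) / (1 - z)" if "n \<ge> 1" for n
  proof -
    have "(\<Prod>i<n. f (Suc i)) = (\<Prod>k = 1..n. f k)"
      by (intro prod.reindex_bij_witness[of _ "\<lambda>k. k - 1" Suc]) auto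
    also have "\<dots> = (1 - z) * (\<Prod>k = 2..n. f k)"
      using that f1 by (simp add: prod.atLeast_Suc_atMost numeral_2_eq_2)
    finally show ?thesis using assms(4) by simp
  qed
  hence "\<forall>\<^sub>F n in sequentially. (\<Prod>i<n. f (Suc i)) / (1 - z) = (\<Prod>k = 2..n. f k)"
    by (intro eventually_sequentiallyI[of 1]) simp
  hence "(\<lambda>n. \<Prod>k = 2..n. f k) \<longlonglongrightarrow> c * (\<Prod>j\<in>J. rGamma (a j)) / (1 - z)"
    using assms(4) by (intro Lim_transform_eventually[OF tendsto_divide[OF lim tendsto_const]]) auto
  thus ?thesis
    unfolding J_eq by (simp add: f_def c_def a_def mult.commute)
qed

end
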